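(* Let $A$ and $B$ be two square positive semi-definite matrices of the same size. Then $$\mathrm{tr}\left(\left(A^{1/2}BA^{1/2}\right)^{1/2}\right)=\sum_{\lambda\in\mathrm{spec}(AB)}\lambda^{1/2}.$$
   Context: Positive semi-definite matrices are real symmetric with nonnegative eigenvalues; $M^{1/2}$ denotes the unique positive semi-definite square root of a positive semi-definite matrix $M$. For a square matrix $M$, $\mathrm{spec}(M)$ is the multiset of (a priori complex) eigenvalues of $M$ counted with (algebraic) multiplicity. Implicit in the right-hand side is that the eigenvalues of $AB$ are nonnegative real numbers, and $\lambda^{1/2}$ is the nonnegative square root. *)

theory Defs
  imports Complex_Main "Jordan_Normal_Form.Char_Poly"
begin

(* The eigenvalues quantified over are the real ones; a real symmetric matrix has no others. *)
definition psd_mat :: "real mat \<Rightarrow> bool" where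
  "psd_mat M \<longleftrightarrow>
     square_mat M \<and> transpose_mat M = M \<and> (\<forall>k. eigenvalue M k \<longrightarrow> 0 \<le> k)"

(* Meaningful only for positive semi-definite M, where such an S exists and is unique. *)
definition psd_sqrt :: "real mat \<Rightarrow> real mat" where
  "psd_sqrt M = (THE S. psd_mat S \<and> S * S = M)"

definition mat_trace :: "'a :: comm_monoid_add mat \<Rightarrow> 'a" where
  "mat_trace M = (\<Sum>i<dim_row M. M $$ (i, i))"

(* The multiset of roots of the characteristic polynomial over the complex numbers, so an
   eigenvalue is repeated according to its algebraic multiplicity. *)
definition spec :: "real mat \<Rightarrow> complex multiset" where
  "spec M = proots (char_poly (map_mat complex_of_real M))"

end

theory Submission
  imports Defs
begin

text \<open>
  Put \<open>S = A\<^sup>1\<^sup>/\<^sup>2\<close> and \<open>R = B\<^sup>1\<^sup>/\<^sup>2\<close>. The characteristic polynomials of \<open>A B = S (S B)\<close> and of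
  \<open>S B S = (S B) S\<close> agree, and \<open>S B S\<close> is positive semi-definite, being the Gram matrix of \<open>R S\<close>.
  Diagonalising \<open>S B S\<close> in an orthonormal basis, with eigenvalues \<open>d i\<close>, diagonalises its square root
  in the same basis with eigenvalues \<open>sqrt (d i)\<close>, and the trace is their sum.
\<close>

section \<open>Diagonal matrices and the trace\<close>

text \<open>The diagonal is a function of the index, so that products and square roots of diagonal
  matrices are taken pointwise under a lambda.\<close>

definition dmat :: "nat \<Rightarrow> (nat \<Rightarrow> 'a) \<Rightarrow> 'a :: zero mat" where
  "dmat n d = mat n n (\<lambda>(i, j). if i = j then d i else 0)"

lemma dmat_carrier [simp]: "dmat n d \<in> carrier_mat n n"
  by (simp add: dmat_def)

lemma dmat_dim [simp]: "dim_row (dmat n d) = n" "dim_col (dmat n d) = n"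
  by (simp_all add: dmat_def)

lemma dmat_index [simp]: "i < n \<Longrightarrow> j < n \<Longrightarrow> dmat n d $$ (i, j) = (if i = j then d i else 0)"
  by (simp add: dmat_def)

lemma transpose_dmat [simp]: "transpose_mat (dmat n d) = dmat n d"
  by (rule eq_matI) auto

lemma index_dmat_mult:
  fixes X :: "'a :: semiring_0 mat"
  assumes "X \<in> carrier_mat n m" "i < n" "j < m"
  shows "(dmat n d * X) $$ (i, j) = d i * X $$ (i, j)"
  using assms by (simp add: scalar_prod_def if_distrib[of "\<lambda>x. x * _"] cong: if_cong)

lemma index_mult_dmat:
  fixes X :: "'a :: semiring_0 mat"
  assumes "X \<in> carrier_mat m n" "i < m" "j < n"
  shows "(X * dmat n d) $$ (i, j) = X $$ (i, j) * d j"
  using assms by (simp add: scalar_prod_def if_distrib[of "\<lambda>x. _ * x"] cong: if_cong)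

lemma dmat_mult_dmat:
  fixes d :: "nat \<Rightarrow> 'a :: semiring_0"
  shows "dmat n d * dmat n e = dmat n (\<lambda>i. d i * e i)"
  by (rule eq_matI) (auto simp: index_dmat_mult[of _ n n] simp del: index_mult_mat(1))

lemma mat_trace_comm:
  fixes X Y :: "'a :: comm_semiring_0 mat"
  assumes "X \<in> carrier_mat n m" "Y \<in> carrier_mat m n"
  shows "mat_trace (X * Y) = mat_trace (Y * X)"
proof -
  have "mat_trace (X * Y) = (\<Sum>i<n. \<Sum>j<m. X $$ (i, j) * Y $$ (j, i))"
    using assms by (simp add: mat_trace_def scalar_prod_def lessThan_atLeast0)
  also have "\<dots> = (\<Sum>j<m. \<Sum>i<n. X $$ (i, j) * Y $$ (j, i))"
    by (rule sum.swap)
  also have "\<dots> = mat_trace (Y * X)"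
    using assms by (simp add: mat_trace_def scalar_prod_def lessThan_atLeast0 mult.commute)
  finally show ?thesis .
qed

section \<open>The characteristic polynomial of a product in either order\<close>

lemma char_poly_mult_commute:
  fixes X Y :: "'a :: idom mat"
  assumes X: "X \<in> carrier_mat n n" and Y: "Y \<in> carrier_mat n n"
  shows "char_poly (X * Y) = char_poly (Y * X)"
proof -
  let ?c = "map_mat (\<lambda>a :: 'a. [:a:])"
  define D where "D = [:0, 1 :: 'a:] \<cdot>\<^sub>m 1\<^sub>m n"
  have D: "D \<in> carrier_mat n n" by (simp add: D_def)
  have cX: "?c X \<in> carrier_mat n n" and cY: "?c Y \<in> carrier_mat n n" using X Y by auto
  interpret const: comm_ring_hom "\<lambda>a :: 'a. [:a:]"
    by unfold_locales auto
  have hom: "?c (P * Q) = ?c P * ?c Q" if "P \<in> carrier_mat n n" "Q \<in> carrier_mat n n" for P Q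
    by (rule const.mat_hom_mult[OF that])
  have cp: "char_poly (P * Q) = det (D - ?c P * ?c Q)"
    if "P \<in> carrier_mat n n" "Q \<in> carrier_mat n n" for P Q
    unfolding char_poly_def char_poly_matrix_def hom[OF that, symmetric] D_def
    by (rule arg_cong[of _ _ det], rule eq_matI) (use that in auto)
  \<comment> \<open>\<open>det ?M\<close> is the characteristic polynomial of \<open>X Y\<close> (Schur complement), while multiplying by \<open>?N\<close>
    makes \<open>?M\<close> block triangular with the characteristic matrix of \<open>Y X\<close> in the corner.\<close>
  let ?M = "four_block_mat D (?c X) (?c Y) (1\<^sub>m n)"
  let ?N = "four_block_mat (1\<^sub>m n) (- ?c X) (0\<^sub>m n n) D"
  \<comment> \<open>\<open>D\<close> is a scalar matrix and commutes with \<open>?c X\<close>; this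
    clears the upper right block of \<open>?M * ?N\<close>.\<close>
  have "D * (- ?c X) + ?c X * D = 0\<^sub>m n n"
    unfolding D_def by (rule eq_matI) (use X in auto)
  moreover have "?c Y * (- ?c X) + 1\<^sub>m n * D = D - ?c Y * ?c X"
    by (rule eq_matI) (use cX cY D in auto)
  ultimately have MN: "?M * ?N = four_block_mat D (0\<^sub>m n n) (?c Y) (D - ?c Y * ?c X)"
    by (subst mult_four_block_mat[where ?nr1.0=n and ?n1.0=n and ?n2.0=n and ?nr2.0=n and ?nc1.0=n and ?nc2.0=n])
      (use cX cY D in auto)
  have M: "?M \<in> carrier_mat (n + n) (n + n)" and N: "?N \<in> carrier_mat (n + n) (n + n)"
    using D by auto
  have "char_poly (X * Y) = det ?M"
    unfolding cp[OF X Y] by (subst det_four_block_mat[of _ n]) (use cX cY D in auto)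
  moreover have "det ?N = det D"
    by (subst det_four_block_mat_lower_left_zero[of _ n _ n]) (use cX D in auto)
  moreover have "det (?M * ?N) = det D * char_poly (Y * X)"
    unfolding MN cp[OF Y X]
    by (subst det_four_block_mat_upper_right_zero[of _ n _ n]) (use cX cY D in auto)
  ultimately have "char_poly (X * Y) * det D = char_poly (Y * X) * det D"
    unfolding det_mult[OF M N] by (simp add: mult.commute)
  \<comment> \<open>\<open>det D\<close> is the n-th power of the indeterminate, so it can be
    cancelled over an integral domain.\<close>
  moreover have "det D \<noteq> 0" by (simp add: D_def)
  ultimately show ?thesis by simp
qed

section \<open>The real spectral theorem\<close>

text \<open>The characteristic polynomial has a complex root because its degree \<open>n\<close> is
  positive. Symmetry makes the matrix Hermitian, which forces that root to be real.\<close>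

lemma symmetric_has_eigenvalue:
  fixes A :: "real mat"
  assumes A: "A \<in> carrier_mat n n" and sym: "transpose_mat A = A" and n: "n > 0"
  obtains e where "eigenvalue A e"
proof -
  let ?C = "map_mat complex_of_real A"
  have C: "?C \<in> carrier_mat n n" using A by simp
  have "degree (char_poly ?C) = n" using degree_monic_char_poly[OF C] by simp
  hence "\<not> constant (poly (char_poly ?C))" using n by (simp add: constant_degree)
  then obtain z where "poly (char_poly ?C) z = 0"
    using fundamental_theorem_of_algebra by blast
  hence "eigenvalue ?C z" using eigenvalue_root_char_poly[OF C] by simp
  then obtain v where v: "v \<in> carrier_vec n" "v \<noteq> 0\<^sub>v n" and ev: "?C *\<^sub>v v = z \<cdot>\<^sub>v v"
    unfolding eigenvalue_def eigenvector_def using A by auto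
  have cC: "conjugate (?C *\<^sub>v v) = ?C *\<^sub>v conjugate v"
    by (rule eq_vecI) (use A v in \<open>auto simp: scalar_prod_def\<close>)
  have tC: "transpose_mat ?C = ?C" using sym by (metis map_mat_transpose)
  \<comment> \<open>Moving \<open>?C\<close> across the Hermitian product replaces \<open>z\<close>
    by \<open>cnj z\<close>; the factor \<open>v \<bullet>c v\<close> is nonzero and
    cancels.\<close>
  have "z * (v \<bullet>c v) = (?C *\<^sub>v v) \<bullet>c v" using ev v by simp
  also have "\<dots> = v \<bullet> (?C *\<^sub>v conjugate v)"
    using transpose_vec_mult_scalar[OF C, of "conjugate v" v] v C tC by simp
  also have "\<dots> = v \<bullet>c (z \<cdot>\<^sub>v v)" using cC ev by simp
  also have "\<dots> = cnj z * (v \<bullet>c v)" using v by (simp add: conjugate_smult_vec)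
  finally have "z = cnj z" using v by simp
  hence z: "z = complex_of_real (Re z)" by (simp add: complex_eq_iff)
  have "poly (map_poly complex_of_real (char_poly A)) (complex_of_real (Re z)) = 0"
    using \<open>poly (char_poly ?C) z = 0\<close> z by (simp add: of_real_hom.char_poly_hom[OF A])
  hence "poly (char_poly A) (Re z) = 0" by simp
  thus ?thesis using that eigenvalue_root_char_poly[OF A] by blast
qed

text \<open>\<open>H\<close> is the reflection exchanging the first unit vector and \<open>w\<close>
  (the identity if they coincide). Its columns extend \<open>w\<close> to an orthonormal basis, and
  it is its own transpose and inverse.\<close>

lemma householder:
  fixes w :: "real vec"
  assumes w: "w \<in> carrier_vec (Suc m)" and norm: "w \<bullet> w = 1"
  obtains H where "H \<in> carrier_mat (Suc m) (Suc m)" "transpose_mat H = H"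
    "H * H = 1\<^sub>m (Suc m)" "col H 0 = w"
proof -
  define u where "u i = (if i = 0 then 1 else 0) - w $ i" for i
  define s where "s = (\<Sum>i = 0..<Suc m. u i * u i)"
  \<comment> \<open>If \<open>w\<close> is the first unit vector then \<open>s = 0\<close>, hence \<open>c = 0\<close> and \<open>H\<close> is the identity.\<close>
  define c where "c = 2 / s"
  define H where "H = mat (Suc m) (Suc m) (\<lambda>(i, j). (if i = j then 1 else 0) - c * u i * u j)"
  have "s = (\<Sum>i = 0..<Suc m. (if i = 0 then 1 else 0) - 2 * (if i = 0 then w $ i else 0) + w $ i * w $ i)"
    unfolding s_def u_def by (rule sum.cong) (auto simp: algebra_simps)
  also have "\<dots> = 2 - 2 * w $ 0"
    using norm w by (simp add: scalar_prod_def sum.distrib sum_subtractf sum_distrib_left[symmetric]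
        del: sum.op_ivl_Suc)
  finally have s: "s = 2 * u 0" by (simp add: u_def)
  \<comment> \<open>As \<open>w\<close> has norm 1, \<open>s = 2 * u 0\<close>, so
    \<open>c * u 0 = 1\<close> unless \<open>s = 0\<close>, in which case every \<open>u i\<close>
    vanishes. Hence column 0 of \<open>H\<close> is the first unit vector minus \<open>u\<close>,
    which is \<open>w\<close>.\<close>
  have u0: "c * u i * u 0 = u i" if "i < Suc m" for i
  proof (cases "s = 0")
    case True
    hence "\<forall>i\<in>{0..<Suc m}. u i * u i = 0"
      unfolding s_def by (subst (asm) sum_nonneg_eq_0_iff) auto
    thus ?thesis using that by simp
  next
    case False
    thus ?thesis using s by (simp add: c_def)
  qed
  \<comment> \<open>Makes the multiples of \<open>u i * u j\<close> in \<open>H * H\<close> cancel;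
    for \<open>s = 0\<close> both sides are 0, since \<open>2 / 0 = 0\<close>.\<close>
  have ccs: "c * c * s = 2 * c" by (simp add: c_def)
  have "H * H = 1\<^sub>m (Suc m)"
  proof (rule eq_matI)
    fix i j assume ij: "i < dim_row (1\<^sub>m (Suc m))" "j < dim_col (1\<^sub>m (Suc m))"
    have "(H * H) $$ (i, j) = (\<Sum>k = 0..<Suc m.
        ((if i = k then 1 else 0) - c * u i * u k) * ((if k = j then 1 else 0) - c * u k * u j))"
      using ij by (simp add: H_def scalar_prod_def del: sum.op_ivl_Suc)
    also have "\<dots> = (\<Sum>k = 0..<Suc m. (if k = i then if i = j then 1 else 0 else 0)
        - (if k = i then c * u i * u j else 0) - (if k = j then c * u i * u j else 0)
        + c * c * u i * u j * (u k * u k))"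
      by (rule sum.cong) (auto simp: algebra_simps)
    also have "\<dots> = (if i = j then 1 else 0) - 2 * c * u i * u j + (c * c * s) * u i * u j"
      using ij by (simp add: sum.distrib sum_subtractf sum_distrib_left[symmetric] s_def
        del: sum.op_ivl_Suc)
    finally show "(H * H) $$ (i, j) = 1\<^sub>m (Suc m) $$ (i, j)"
      using ij by (simp add: ccs)
  qed (auto simp: H_def)
  moreover have "transpose_mat H = H"
    by (rule eq_matI) (auto simp: H_def)
  moreover have "col H 0 = w"
  proof (rule eq_vecI)
    fix i assume "i < dim_vec w"
    hence i: "i < Suc m" using w by simp
    hence "col H 0 $ i = (if i = 0 then 1 else 0) - c * u i * u 0" by (simp add: H_def)
    also have "\<dots> = w $ i" unfolding u0[OF i] by (simp add: u_def)
    finally show "col H 0 $ i = w $ i" .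
  qed (use w in \<open>simp add: H_def\<close>)
  ultimately show ?thesis using that[of H] by (simp add: H_def)
qed

definition orth_mat :: "nat \<Rightarrow> real mat \<Rightarrow> bool" where
  "orth_mat n P \<longleftrightarrow>
     P \<in> carrier_mat n n \<and> P * transpose_mat P = 1\<^sub>m n \<and> transpose_mat P * P = 1\<^sub>m n"

text \<open>Deflation: conjugating by a reflection turns a unit eigenvector into the first basis
  vector. Symmetry then splits off a 1 by 1 block, and the induction hypothesis diagonalises the
  remaining block.\<close>

lemma real_spectral_theorem:
  fixes A :: "real mat"
  assumes "A \<in> carrier_mat n n" and "transpose_mat A = A"
  shows "\<exists>P d. orth_mat n P \<and> A = P * dmat n d * transpose_mat P"
  using assms
proof (induction n arbitrary: A)
  case 0
  thus ?case by (intro exI[of _ "1\<^sub>m 0"] exI[of _ "\<lambda>_. 0"]) (auto simp: orth_mat_def)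
next
  case (Suc m)
  let ?n = "Suc m"
  note A = Suc.prems(1) and sym = Suc.prems(2)
  obtain e where "eigenvalue A e"
    using symmetric_has_eigenvalue[OF A sym] by auto
  then obtain v where v: "v \<in> carrier_vec ?n" "v \<noteq> 0\<^sub>v ?n" and Av: "A *\<^sub>v v = e \<cdot>\<^sub>v v"
    unfolding eigenvalue_def eigenvector_def using A by auto
  have vv: "v \<bullet> v > 0"
    using conjugate_square_greater_0_vec[OF v(1)] v(2) by simp
  define w where "w = (1 / sqrt (v \<bullet> v)) \<cdot>\<^sub>v v"
  have w: "w \<in> carrier_vec ?n" using v by (simp add: w_def)
  have ww: "w \<bullet> w = 1"
    using v vv by (simp add: w_def field_simps)
  have Aw: "A *\<^sub>v w = e \<cdot>\<^sub>v w"
    using A v Av by (simp add: w_def mult_mat_vec smult_smult_assoc mult.commute)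
  obtain H where H: "H \<in> carrier_mat ?n ?n" and Hsym: "transpose_mat H = H"
    and HH: "H * H = 1\<^sub>m ?n" and Hw: "col H 0 = w"
    using householder[OF w ww] .
  define B where "B = H * A * H"
  have B: "B \<in> carrier_mat ?n ?n" using H A by (simp add: B_def)
  have Bsym: "transpose_mat B = B"
    unfolding B_def using H A Hsym sym
    by (simp add: transpose_mult[of _ ?n ?n _ ?n] assoc_mult_mat[of _ ?n ?n _ ?n _ ?n] mult_carrier_mat[of _ ?n ?n _ ?n])
  have HBH: "A = H * B * H"
  proof -
    have "H * B * H = (H * H) * A * (H * H)"
      unfolding B_def using H A by (simp add: assoc_mult_mat[of _ ?n ?n _ ?n _ ?n] mult_carrier_mat[of _ ?n ?n _ ?n])
    thus ?thesis using HH A by simp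
  qed
  \<comment> \<open>Column 0 of \<open>H\<close> is \<open>w\<close>, so \<open>B\<close> sends the
    first unit vector to \<open>H A w = e H w\<close>, and \<open>H w\<close> is column 0 of
    \<open>H * H\<close>, the first unit vector again.\<close>
  have "col B 0 = (H * A) *\<^sub>v w"
    unfolding B_def Hw[symmetric] using H A by (subst col_mult2[of _ ?n ?n _ ?n]) auto
  also have "\<dots> = e \<cdot>\<^sub>v (H *\<^sub>v w)"
    using H A w Aw by (simp add: mult_mat_vec)
  also have "H *\<^sub>v w = col (H * H) 0"
    unfolding Hw[symmetric] using H by (subst col_mult2[of _ ?n ?n _ ?n]) auto
  finally have col0: "col B 0 = e \<cdot>\<^sub>v unit_vec ?n 0"
    by (simp add: HH)
  have B0: "B $$ (i, 0) = (if i = 0 then e else 0)" if "i < ?n" for i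
    using arg_cong[OF col0, of "\<lambda>x. x $ i"] that B by (simp add: unit_vec_def)
  have B0': "B $$ (0, i) = (if i = 0 then e else 0)" if "i < ?n" for i
    using B0[OF that] arg_cong[OF Bsym, of "\<lambda>x. x $$ (0, i)"] that B by simp
  define C where "C = mat m m (\<lambda>(i, j). B $$ (Suc i, Suc j))"
  have C: "C \<in> carrier_mat m m" by (simp add: C_def)
  have "transpose_mat C = C"
  proof (rule eq_matI)
    fix i j assume "i < dim_row C" "j < dim_col C"
    thus "transpose_mat C $$ (i, j) = C $$ (i, j)"
      using arg_cong[OF Bsym, of "\<lambda>x. x $$ (Suc i, Suc j)"] B by (simp add: C_def)
  qed (simp_all add: C_def)
  from Suc.IH[OF C this] obtain Q d where Q: "Q \<in> carrier_mat m m"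
    and QQ: "Q * transpose_mat Q = 1\<^sub>m m" "transpose_mat Q * Q = 1\<^sub>m m"
    and CQ: "C = Q * dmat m d * transpose_mat Q" unfolding orth_mat_def by blast
  \<comment> \<open>\<open>B\<close> is the block sum of \<open>e\<close> and \<open>C\<close>, so
    it is diagonalised by the block sum \<open>R\<close> of 1 and \<open>Q\<close>; the matrix
    sought for \<open>A\<close> is then \<open>H * R\<close>.\<close>
  let ?block = "\<lambda>X Y. four_block_mat X (0\<^sub>m 1 m) (0\<^sub>m m 1) Y"
  let ?E = "dmat 1 (\<lambda>_. e)"
  define R where "R = ?block (1\<^sub>m 1) Q"
  have R: "R \<in> carrier_mat ?n ?n" unfolding R_def using four_block_carrier_mat[of "1\<^sub>m 1" 1 1 Q m m] Q by simp
  have Rt: "transpose_mat R = ?block (1\<^sub>m 1) (transpose_mat Q)"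
    unfolding R_def using Q
    by (subst transpose_four_block_mat[of _ 1 1 _ m _ m]) auto
  have mult: "?block X Y * ?block X' Y' = ?block (X * X') (Y * Y')"
    if "X \<in> carrier_mat 1 1" "X' \<in> carrier_mat 1 1" "Y \<in> carrier_mat m m" "Y' \<in> carrier_mat m m"
    for X X' Y Y' :: "real mat"
    using that
    by (subst mult_four_block_mat[where ?nr1.0=1 and ?n1.0=1 and ?n2.0=m and ?nr2.0=m and ?nc1.0=1 and ?nc2.0=m])
      auto
  have RR: "R * transpose_mat R = 1\<^sub>m ?n" "transpose_mat R * R = 1\<^sub>m ?n"
    unfolding Rt unfolding R_def using Q QQ by (simp_all add: mult del: One_nat_def) simp_all
  define f where "f = (\<lambda>i. case i of 0 \<Rightarrow> e | Suc j \<Rightarrow> d j)"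
  have "dmat ?n f = ?block ?E (dmat m d)"
    by (rule eq_matI) (auto simp: f_def split: nat.splits)
  hence "R * dmat ?n f * transpose_mat R = ?block ?E C"
    unfolding Rt unfolding R_def CQ using Q
    by (simp add: mult mult_carrier_mat[of _ m m _ m] del: One_nat_def)
  also have "\<dots> = B"
    by (rule eq_matI) (use B B0 B0' in \<open>auto simp: C_def\<close>)
  finally have BR: "B = R * dmat ?n f * transpose_mat R" by simp
  show ?case
    unfolding orth_mat_def
  proof (intro exI conjI)
    show HR: "H * R \<in> carrier_mat ?n ?n" using H R by simp
    have t: "transpose_mat (H * R) = transpose_mat R * H"
      using H R Hsym by (simp add: transpose_mult[of _ ?n ?n])
    have "H * R * (transpose_mat R * H) = H * (R * transpose_mat R) * H"
      using H R by (simp add: assoc_mult_mat[of _ ?n ?n _ ?n _ ?n] mult_carrier_mat[of _ ?n ?n _ ?n])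
    thus "H * R * transpose_mat (H * R) = 1\<^sub>m ?n" unfolding t RR using H HH by simp
    have "transpose_mat R * H * (H * R) = transpose_mat R * (H * H) * R"
      using H R by (simp add: assoc_mult_mat[of _ ?n ?n _ ?n _ ?n] mult_carrier_mat[of _ ?n ?n _ ?n])
    thus "transpose_mat (H * R) * (H * R) = 1\<^sub>m ?n" unfolding t HH using R RR by simp
    show "A = H * R * dmat ?n f * transpose_mat (H * R)"
      unfolding t by (subst HBH, subst BR)
        (use H R in \<open>simp add: assoc_mult_mat[of _ ?n ?n _ ?n _ ?n] mult_carrier_mat[of _ ?n ?n _ ?n]\<close>)
  qed
qed

section \<open>Positive semi-definite matrices in diagonal form\<close>

lemma orth_matD:
  assumes "orth_mat n P"
  shows "P \<in> carrier_mat n n" "P * transpose_mat P = 1\<^sub>m n" "transpose_mat P * P = 1\<^sub>m n"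
  using assms by (simp_all add: orth_mat_def)

lemma orth_conj_carrier:
  assumes "orth_mat n P" and "D \<in> carrier_mat n n"
  shows "P * D * transpose_mat P \<in> carrier_mat n n"
  using assms unfolding orth_mat_def by (meson mult_carrier_mat transpose_carrier_mat)

lemma orth_conj_mult:
  assumes P: "orth_mat n P" and D: "D \<in> carrier_mat n n" and E: "E \<in> carrier_mat n n"
  shows "(P * D * transpose_mat P) * (P * E * transpose_mat P) = P * (D * E) * transpose_mat P"
proof -
  have "(P * D * transpose_mat P) * (P * E * transpose_mat P)
      = P * D * (transpose_mat P * P) * E * transpose_mat P"
    using orth_matD(1)[OF P] D E by (simp add: assoc_mult_mat[of _ n n _ n _ n] mult_carrier_mat[of _ n n _ n])
  also have "transpose_mat P * P = 1\<^sub>m n"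
    using orth_matD[OF P] by simp
  also have "P * D * 1\<^sub>m n * E * transpose_mat P = P * (D * E) * transpose_mat P"
    using orth_matD(1)[OF P] D E by (simp add: assoc_mult_mat[of _ n n _ n _ n] mult_carrier_mat[of _ n n _ n])
  finally show ?thesis .
qed

lemma char_poly_orth_diag:
  assumes P: "orth_mat n P"
  shows "char_poly (P * dmat n d * transpose_mat P) = (\<Prod>i<n. [:- d i, 1:])"
proof -
  have "similar_mat (P * dmat n d * transpose_mat P) (dmat n d)"
    by (rule similar_matI[of _ _ P "transpose_mat P" n]) (use orth_matD[OF P] in auto)
  hence "char_poly (P * dmat n d * transpose_mat P) = char_poly (dmat n d)"
    by (rule char_poly_similar)
  also have "\<dots> = (\<Prod>a\<leftarrow>diag_mat (dmat n d). [:- a, 1:])"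
    by (rule char_poly_upper_triangular[of _ n]) (auto simp: upper_triangular_def)
  also have "diag_mat (dmat n d) = map d [0..<n]"
    by (auto simp: diag_mat_def)
  finally show ?thesis
    by (simp add: prod.list_conv_set_nth lessThan_atLeast0)
qed

text \<open>The characteristic polynomial splits, so the eigenvalues are exactly the
  \<open>d i\<close>. One direction extracts nonnegative eigenvalues, the other certifies candidate
  square roots.\<close>

lemma psd_orth_diag_iff:
  assumes P: "orth_mat n P"
  shows "psd_mat (P * dmat n d * transpose_mat P) \<longleftrightarrow> (\<forall>i<n. 0 \<le> d i)"
proof -
  let ?M = "P * dmat n d * transpose_mat P"
  have M: "?M \<in> carrier_mat n n" using P by (simp add: orth_conj_carrier)
  have "transpose_mat ?M = ?M"
    using orth_matD(1)[OF P] by (simp add: transpose_mult[of _ n n _ n] assoc_mult_mat[of _ n n _ n _ n] mult_carrier_mat[of _ n n _ n])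
  moreover have "eigenvalue ?M k \<longleftrightarrow> (\<exists>i<n. k = d i)" for k
    unfolding eigenvalue_root_char_poly[OF M] char_poly_orth_diag[OF P]
    by (auto simp: poly_prod)
  ultimately show ?thesis using M by (auto simp: psd_mat_def)
qed

lemma psd_mat_orth_diag:
  assumes "M \<in> carrier_mat n n" and "psd_mat M"
  obtains P d where "orth_mat n P" "\<forall>i<n. 0 \<le> d i" "M = P * dmat n d * transpose_mat P"
proof -
  have "transpose_mat M = M" using assms by (simp add: psd_mat_def)
  from real_spectral_theorem[OF assms(1) this] obtain P d
    where P: "orth_mat n P" and M: "M = P * dmat n d * transpose_mat P" by blast
  have "\<forall>i<n. 0 \<le> d i" using assms(2) unfolding M psd_orth_diag_iff[OF P] .
  thus ?thesis using that P M by blast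
qed

section \<open>Existence and uniqueness of the square root\<close>

text \<open>\<open>X\<close> is the change of basis between eigenbases of \<open>S\<close> and
  \<open>T\<close>. Equal squares mean that it intertwines the squared diagonals; it then
  intertwines the diagonals themselves, which gives \<open>S = T\<close>.\<close>

lemma psd_mat_sqrt_unique:
  assumes S: "S \<in> carrier_mat n n" "psd_mat S" and T: "T \<in> carrier_mat n n" "psd_mat T"
    and eq: "S * S = T * T"
  shows "S = T"
proof -
  obtain P d where P: "orth_mat n P" and d: "\<forall>i<n. 0 \<le> d i"
    and SP: "S = P * dmat n d * transpose_mat P" using psd_mat_orth_diag[OF S] .
  obtain Q f where Q: "orth_mat n Q" and f: "\<forall>i<n. 0 \<le> f i"
    and TQ: "T = Q * dmat n f * transpose_mat Q" using psd_mat_orth_diag[OF T] .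
  define X where "X = transpose_mat P * Q"
  have cP: "P \<in> carrier_mat n n" and cQ: "Q \<in> carrier_mat n n"
    using orth_matD[OF P] orth_matD[OF Q] by auto
  have X: "X \<in> carrier_mat n n" using cP cQ by (simp add: X_def)
  have PX: "P * X = Q" and XQ: "X * transpose_mat Q = transpose_mat P"
    using orth_matD[OF P] orth_matD[OF Q] assoc_mult_mat[of P n n "transpose_mat P" n Q n]
      assoc_mult_mat[of "transpose_mat P" n n Q n "transpose_mat Q" n]
    by (simp_all add: X_def)
  \<comment> \<open>Multiplying \<open>S * S = T * T\<close> by \<open>transpose_mat P\<close> on
    the left and \<open>Q\<close> on the right turns it into an equation about
    \<open>X\<close>.\<close>
  have intertwine: "transpose_mat P * (P * D * transpose_mat P) * Q = D * X"
    "transpose_mat P * (Q * D * transpose_mat Q) * Q = X * D"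
    if D: "D \<in> carrier_mat n n" for D
  proof -
    have "transpose_mat P * (P * D * transpose_mat P) * Q = (transpose_mat P * P) * D * X"
      using cP cQ D by (simp add: X_def assoc_mult_mat[of _ n n _ n _ n] mult_carrier_mat[of _ n n _ n])
    thus "transpose_mat P * (P * D * transpose_mat P) * Q = D * X"
      using orth_matD[OF P] D by simp
    have "transpose_mat P * (Q * D * transpose_mat Q) * Q = X * D * (transpose_mat Q * Q)"
      using cP cQ D by (simp add: X_def assoc_mult_mat[of _ n n _ n _ n] mult_carrier_mat[of _ n n _ n])
    thus "transpose_mat P * (Q * D * transpose_mat Q) * Q = X * D"
      using orth_matD[OF Q] D X by simp
  qed
  \<comment> \<open>Entrywise \<open>d\<^sub>i\<^sup>2 X\<^sub>i\<^sub>j = X\<^sub>i\<^sub>j f\<^sub>j\<^sup>2\<close> with \<open>d\<close>, \<open>f\<close> nonnegative, so the squares can be dropped.\<close>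
  have "dmat n (\<lambda>i. d i * d i) * X = X * dmat n (\<lambda>i. f i * f i)"
    using eq unfolding SP TQ orth_conj_mult[OF P dmat_carrier dmat_carrier]
      orth_conj_mult[OF Q dmat_carrier dmat_carrier] dmat_mult_dmat
    using intertwine[OF dmat_carrier] by metis
  hence sq: "(d i * d i) * X $$ (i, j) = X $$ (i, j) * (f j * f j)" if "i < n" "j < n" for i j
    using index_dmat_mult[OF X that] index_mult_dmat[OF X that] by metis
  have DX: "dmat n d * X = X * dmat n f"
  proof (rule eq_matI)
    fix i j assume "i < dim_row (X * dmat n f)" "j < dim_col (X * dmat n f)"
    hence ij: "i < n" "j < n" using X by auto
    have "d i = f j" if "X $$ (i, j) \<noteq> 0"
      using sq[OF ij] that d f ij
      by (simp add: mult.commute power2_eq_square[symmetric])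
    thus "(dmat n d * X) $$ (i, j) = (X * dmat n f) $$ (i, j)"
      unfolding index_dmat_mult[OF X ij] index_mult_dmat[OF X ij] by auto
  qed (use X in auto)
  \<comment> \<open>Here \<open>transpose_mat P\<close> is rewritten as
    \<open>X * transpose_mat Q\<close>; after \<open>X\<close> passes the diagonal,
    \<open>P * X = Q\<close> yields \<open>T\<close>.\<close>
  have "S = P * (dmat n d * X) * transpose_mat Q"
    unfolding SP XQ[symmetric] using cP cQ X
    by (simp add: assoc_mult_mat[of _ n n _ n _ n] mult_carrier_mat[of _ n n _ n])
  also have "\<dots> = T"
    unfolding TQ DX using cP cQ X
    by (subst assoc_mult_mat[of P n n X n "dmat n f" n, symmetric]) (auto simp: PX)
  finally show ?thesis .
qed

text \<open>Evaluates the definite description: the matrix with square-rooted diagonal is a positive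
  semi-definite root, and uniqueness excludes any other.\<close>

lemma psd_sqrt_orth_diag:
  assumes P: "orth_mat n P" and d: "\<forall>i<n. 0 \<le> d i"
  shows "psd_sqrt (P * dmat n d * transpose_mat P) = P * dmat n (\<lambda>i. sqrt (d i)) * transpose_mat P"
    (is "psd_sqrt ?M = ?S")
proof -
  have S: "?S \<in> carrier_mat n n" "psd_mat ?S"
    using P d by (simp_all add: orth_conj_carrier psd_orth_diag_iff[OF P])
  have "dmat n (\<lambda>i. sqrt (d i) * sqrt (d i)) = dmat n d"
    by (rule eq_matI) (auto simp: d)
  hence SS: "?S * ?S = ?M"
    unfolding orth_conj_mult[OF P dmat_carrier dmat_carrier] dmat_mult_dmat by simp
  show ?thesis unfolding psd_sqrt_def
  proof (rule the_equality)
    show "psd_mat ?S \<and> ?S * ?S = ?M" using S SS by blast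
    \<comment> \<open>The definite description does not fix the size of \<open>T\<close>; it is
      recovered from \<open>T * T\<close> and squareness.\<close>
    fix T assume T: "psd_mat T \<and> T * T = ?M"
    hence "dim_row (T * T) = n" using orth_matD(1)[OF P] by simp
    moreover have "dim_col T = dim_row T" using T by (simp add: psd_mat_def)
    ultimately have "T \<in> carrier_mat n n" by (intro carrier_matI) simp_all
    thus "T = ?S" using T SS by (intro psd_mat_sqrt_unique[OF _ _ S]) (metis+)
  qed
qed

lemma psd_sqrt:
  assumes "M \<in> carrier_mat n n" and "psd_mat M"
  shows "psd_sqrt M \<in> carrier_mat n n" "psd_mat (psd_sqrt M)" "psd_sqrt M * psd_sqrt M = M"
proof -
  obtain P d where P: "orth_mat n P" and d: "\<forall>i<n. 0 \<le> d i"
    and M: "M = P * dmat n d * transpose_mat P" using psd_mat_orth_diag[OF assms] .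
  note S = psd_sqrt_orth_diag[OF P d]
  show "psd_sqrt M \<in> carrier_mat n n" "psd_mat (psd_sqrt M)"
    using P d by (simp_all add: M S orth_conj_carrier psd_orth_diag_iff[OF P])
  have "dmat n (\<lambda>i. sqrt (d i) * sqrt (d i)) = dmat n d"
    by (rule eq_matI) (auto simp: d)
  thus "psd_sqrt M * psd_sqrt M = M"
    unfolding M S orth_conj_mult[OF P dmat_carrier dmat_carrier] dmat_mult_dmat by simp
qed

text \<open>The trace is invariant under cyclic permutation, so the orthogonal factors
  cancel.\<close>

lemma mat_trace_psd_sqrt:
  assumes P: "orth_mat n P" and d: "\<forall>i<n. 0 \<le> d i"
  shows "mat_trace (psd_sqrt (P * dmat n d * transpose_mat P)) = (\<Sum>i<n. sqrt (d i))"
proof -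
  let ?D = "dmat n (\<lambda>i. sqrt (d i))"
  have cP: "P \<in> carrier_mat n n" using orth_matD[OF P] by simp
  have "mat_trace (P * ?D * transpose_mat P) = mat_trace (transpose_mat P * (P * ?D))"
    by (rule mat_trace_comm[of _ n n]) (use cP in auto)
  also have "transpose_mat P * (P * ?D) = ?D"
    using orth_matD[OF P] assoc_mult_mat[of "transpose_mat P" n n P n ?D n] by simp
  also have "mat_trace ?D = (\<Sum>i<n. sqrt (d i))"
    by (simp add: mat_trace_def)
  finally show ?thesis by (simp add: psd_sqrt_orth_diag[OF P d])
qed

section \<open>Gram matrices, spectra and the trace identity\<close>

text \<open>An eigenvector \<open>v\<close> for \<open>k\<close> satisfies \<open>k * (v \<bullet>
  v) = (X *\<^sub>v v) \<bullet> (X *\<^sub>v v)\<close>, which is nonnegative, while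
  \<open>v \<bullet> v\<close> is positive.\<close>

lemma psd_mat_gram:
  assumes X: "X \<in> carrier_mat m n"
  shows "psd_mat (transpose_mat X * X)"
  unfolding psd_mat_def
proof (intro conjI allI impI)
  show "square_mat (transpose_mat X * X)" by simp
  show "transpose_mat (transpose_mat X * X) = transpose_mat X * X"
    using X by (simp add: transpose_mult[of _ n m])
  fix k assume "eigenvalue (transpose_mat X * X) k"
  then obtain v where v: "v \<in> carrier_vec n" "v \<noteq> 0\<^sub>v n"
    and ev: "(transpose_mat X * X) *\<^sub>v v = k \<cdot>\<^sub>v v"
    unfolding eigenvalue_def eigenvector_def using X by auto
  have "k * (v \<bullet> v) = (transpose_mat X *\<^sub>v (X *\<^sub>v v)) \<bullet> v"
    using X v ev by (simp add: assoc_mult_mat_vec[of _ n m _ n])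
  also have "\<dots> = (X *\<^sub>v v) \<bullet> (X *\<^sub>v v)"
    using X v by (simp add: transpose_vec_mult_scalar[of _ m n])
  also have "\<dots> \<ge> 0"
    using conjugate_square_ge_0_vec[of "X *\<^sub>v v"] by simp
  finally have "k * (v \<bullet> v) \<ge> 0" .
  moreover have "v \<bullet> v > 0"
    using conjugate_square_greater_0_vec[OF v(1)] v(2) by simp
  ultimately show "0 \<le> k" by (simp add: zero_le_mult_iff)
qed

text \<open>The factorisation carries over to the complex numbers, and the roots of a product, with
  multiplicity, are the sum of the root multisets of its factors.\<close>

lemma spec_char_poly_prod:
  assumes "M \<in> carrier_mat n n" and "char_poly M = (\<Prod>i<n. [:- d i, 1:])"
  shows "spec M = image_mset (\<lambda>i. complex_of_real (d i)) (mset_set {..<n})"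
proof -
  interpret map_poly_hom: map_poly_comm_ring_hom complex_of_real ..
  have "char_poly (map_mat complex_of_real M) = (\<Prod>i<n. [:- complex_of_real (d i), 1:])"
    unfolding of_real_hom.char_poly_hom[OF assms(1)] assms(2)
    by (simp add: map_poly_hom.hom_prod)
  hence "spec M = (\<Sum>i<n. {#complex_of_real (d i)#})"
    unfolding spec_def by (simp add: proots_prod)
  also have "\<dots> = image_mset (\<lambda>i. complex_of_real (d i)) (mset_set {..<n})"
    by (induction n) (simp_all add: lessThan_Suc)
  finally show ?thesis .
qed

theorem theorem4p1:
  fixes A B :: "real mat" and n :: nat
  assumes "A \<in> carrier_mat n n" and "B \<in> carrier_mat n n"
    and "psd_mat A" and "psd_mat B"
  shows "(\<forall>l \<in># spec (A * B). l \<in> \<real> \<and> 0 \<le> Re l) \<and>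
    mat_trace (psd_sqrt (psd_sqrt A * B * psd_sqrt A)) = (\<Sum>l \<in># spec (A * B). sqrt (Re l))"
proof -
  define S where "S = psd_sqrt A"
  define R where "R = psd_sqrt B"
  have S: "S \<in> carrier_mat n n" "transpose_mat S = S" "S * S = A"
    using psd_sqrt[OF assms(1,3)] by (auto simp: S_def psd_mat_def)
  have R: "R \<in> carrier_mat n n" "transpose_mat R = R" "R * R = B"
    using psd_sqrt[OF assms(2,4)] by (auto simp: R_def psd_mat_def)
  have M: "S * B * S \<in> carrier_mat n n" using S assms(2) by simp
  have "S * B * S = transpose_mat (R * S) * (R * S)"
    using S R by (simp add: R(3)[symmetric] transpose_mult[of _ n n _ n] assoc_mult_mat[of _ n n _ n _ n] mult_carrier_mat[of _ n n _ n])
  hence "psd_mat (S * B * S)"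
    using psd_mat_gram[of "R * S" n n] S R by simp
  from psd_mat_orth_diag[OF M this] obtain P d where P: "orth_mat n P"
    and d: "\<forall>i<n. 0 \<le> d i" and SBS: "S * B * S = P * dmat n d * transpose_mat P" .
  have "A * B = S * (S * B)"
    using S assms(2) by (simp add: S(3)[symmetric] assoc_mult_mat[of _ n n _ n _ n] mult_carrier_mat[of _ n n _ n])
  hence "char_poly (A * B) = char_poly (S * B * S)"
    using char_poly_mult_commute[OF S(1), of "S * B"] S assms(2) by simp
  \<comment> \<open>\<open>A * B\<close> need not be symmetric; its eigenvalues are real and
    nonnegative because they are the eigenvalues \<open>d i\<close> of
    \<open>S * B * S\<close>.\<close>
  hence spec: "spec (A * B) = image_mset (\<lambda>i. complex_of_real (d i)) (mset_set {..<n})"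
    using assms(1,2) char_poly_orth_diag[OF P] by (intro spec_char_poly_prod) (auto simp: SBS)
  have "mat_trace (psd_sqrt (S * B * S)) = (\<Sum>l\<in>#spec (A * B). sqrt (Re l))"
    unfolding SBS spec mat_trace_psd_sqrt[OF P d]
    by (simp add: image_mset.compositionality o_def sum_unfold_sum_mset)
  moreover have "\<forall>l\<in>#spec (A * B). l \<in> \<real> \<and> 0 \<le> Re l"
    unfolding spec using d by auto
  ultimately show ?thesis by (simp add: S_def)
qed

end
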